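(* Let $(G_m)_{m\in\mathbb{Z}}$ be a generalized Fibonacci sequence and let $n\ge 0$ be an integer. Then $$\sum_{k=0}^n G_k G_{n-k} = \frac{1}{5} \left\{ \left[ (3n+5)G_0 - (n+1)G_1 \right] G_n - \left[ (n-1)G_0 - 2nG_1 \right] G_{n+1} \right\}.$$
   Context: A generalized Fibonacci sequence is a sequence $(G_m)_{m\in\mathbb{Z}}$ of complex numbers with $G_{m+2}=G_{m+1}+G_m$ for all integers $m$ (with arbitrary seed $G_0,G_1$). *)

theory Defs
  imports Complex_Main
begin

definition generalized_fibonacci :: "(int \<Rightarrow> complex) \<Rightarrow> bool" where
  "generalized_fibonacci G \<longleftrightarrow> (\<forall>m. G (m + 2) = G (m + 1) + G m)"

end

theory Submission
  imports Defs
begin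

text \<open>Both sides, as functions of \<open>n\<close>, satisfy the same inhomogeneous Fibonacci
  recurrence, with forcing term \<open>G 0 * G n + G 1 * G (n + 1)\<close>, and they agree at 0 and
  1; two-step induction concludes. For the convolution this is
  \<open>generalized_fibonacci_convolution_rec\<close>; for the closed form it is a direct
  computation. The forcing term itself solves the homogeneous recurrence, and this resonance
  accounts for the coefficients linear in \<open>n\<close>.\<close>

lemma generalized_fibonacci_convolution_rec:
  fixes G :: "int \<Rightarrow> complex" and n :: int
  assumes G: "generalized_fibonacci G" and n: "n \<ge> 0"
  shows "(\<Sum>k=0..n+2. G k * G (n + 2 - k)) =
    (\<Sum>k=0..n+1. G k * G (n + 1 - k)) + (\<Sum>k=0..n. G k * G (n - k))
    + G 0 * G n + G 1 * G (n + 1)"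
proof -
  have rec: "G (m + 2) = G (m + 1) + G m" for m
    using G by (simp add: generalized_fibonacci_def)
  have ivl1: "{0..n+1} = insert (n+1) {0..n}" and ivl2: "{0..n+2} = insert (n+2) {0..n+1}"
    using n by auto
  have step: "G (n + 2 - k) = G (n + 1 - k) + G (n - k)" for k
    using rec[of "n - k"] by (simp add: algebra_simps)
  \<comment> \<open>The top two terms are peeled off before the second factor is expanded, since for
    them \<open>n - k\<close> would be negative.\<close>
  have "(\<Sum>k=0..n+2. G k * G (n + 2 - k))
      = (\<Sum>k=0..n. G k * G (n + 2 - k)) + G (n + 1) * G 1 + G (n + 2) * G 0"
    by (simp add: ivl1 ivl2)
  also have "(\<Sum>k=0..n. G k * G (n + 2 - k))
      = (\<Sum>k=0..n. G k * G (n + 1 - k)) + (\<Sum>k=0..n. G k * G (n - k))"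
    by (simp only: step distrib_left sum.distrib)
  \<comment> \<open>Completing this convolution costs \<open>G (n + 1) * G 0\<close>, which combines
    with the peeled \<open>G (n + 2) * G 0\<close> to leave \<open>G 0 * G n\<close>.\<close>
  also have "(\<Sum>k=0..n. G k * G (n + 1 - k))
      = (\<Sum>k=0..n+1. G k * G (n + 1 - k)) - G (n + 1) * G 0"
    by (simp add: ivl1)
  finally show ?thesis
    by (simp add: rec[of n] algebra_simps)
qed

theorem mainTheorem9:
  fixes G :: "int \<Rightarrow> complex" and n :: int
  assumes "generalized_fibonacci G" and "n \<ge> 0"
  shows "(\<Sum>k=0..n. G k * G (n - k)) =
    1 / 5 * (((3 * of_int n + 5) * G 0 - (of_int n + 1) * G 1) * G n
             - ((of_int n - 1) * G 0 - 2 * of_int n * G 1) * G (n + 1))"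
proof -
  have rec: "G (m + 2) = G (m + 1) + G m" for m
    using assms(1) by (simp add: generalized_fibonacci_def)
  define F where "F n =
    1 / 5 * (((3 * of_int n + 5) * G 0 - (of_int n + 1) * G 1) * G n
             - ((of_int n - 1) * G 0 - 2 * of_int n * G 1) * G (n + 1))" for n
  have F_rec: "F (n + 2) = F (n + 1) + F n + G 0 * G n + G 1 * G (n + 1)" for n
  proof -
    \<comment> \<open>\<open>F (n + 2)\<close> reaches up to \<open>G (n + 3)\<close>. Once
      everything is written in \<open>G n\<close> and \<open>G (n + 1)\<close>, only a polynomial
      identity remains.\<close>
    have "G (n + 3) = 2 * G (n + 1) + G n"
      using rec[of "n + 1"] rec[of n] by (simp add: add.assoc)
    then show ?thesis
      using rec[of n] by (simp add: F_def add.assoc) (simp add: field_simps)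
  qed
  \<comment> \<open>Passing to natural numbers makes two-step induction available;
    \<open>nat n\<close> returns to the integer \<open>n\<close> because \<open>n\<close> is
    nonnegative.\<close>
  have "(\<Sum>k=0..int m. G k * G (int m - k)) = F (int m)" for m
  proof (induction m rule: induct_nat_012)
    case 0
    then show ?case by (simp add: F_def algebra_simps)
  next
    case 1
    have "{0..1::int} = {0, 1}" by auto
    moreover have "G 2 = G 1 + G 0"
      using rec[of 0] by simp
    ultimately show ?case
      by (simp add: F_def) (simp add: field_simps)
  next
    case (ge2 m)
    have suc: "int (Suc m) = int m + 1" "int (Suc (Suc m)) = int m + 2"
      by simp_all
    show ?case
      using ge2 generalized_fibonacci_convolution_rec[OF assms(1), of "int m"] F_rec[of "int m"]
      unfolding suc by simp
  qed
  from this[of "nat n"] show ?thesis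
    using assms(2) by (simp add: F_def)
qed

end
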